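(* Let $\Bbbk$ be a field of characteristic $0$ and let $\mathfrak{g}$ be an infinite-dimensional Lie subalgebra of $W_{\geq -1} = \operatorname{Der}(\Bbbk[t])$. Then there exists a non-constant polynomial $f \in \Bbbk[t]$ such that: (1) the field of ratios $F(\mathfrak{g})$ is generated by $f$, i.e. $F(\mathfrak{g}) = \Bbbk(f)$; (2) the subalgebra $\mathfrak{g}$ is contained in $L(f)$.
   Context: $W_{\geq -1} = \operatorname{Der}(\Bbbk[t]) = \Bbbk[t]\partial$, where $\partial$ is differentiation with respect to $t$, with Lie bracket $[f\partial, g\partial] = (fg' - f'g)\partial$. For a Lie subalgebra $\mathfrak{g} \subseteq W_{\geq -1}$, the set of ratios is $R(\mathfrak{g}) = \{ \frac{w}{u} \in \Bbbk(t) \mid w\partial, u\partial \in \mathfrak{g},\ u \neq 0\}$, and the field of ratios $F(\mathfrak{g}) = \Bbbk(R(\mathfrak{g}))$ is the subfield of $\Bbbk(t)$ generated over $\Bbbk$ by $R(\mathfrak{g})$. For a non-constant polynomial $f \in \Bbbk[t]$, let $g_f \in \Bbbk[t]\setminus\{0\}$ be a polynomial of minimal degree among all nonzero $g \in \Bbbk[t]$ with $f'g \in \Bbbk[f]$; such $g_f$ exists and is unique up to a nonzero scalar. Set $L(f) = \Bbbk[f]\, g_f\, \partial = \{p(f) g_f \partial \mid p \in \Bbbk[t]\}$, which is a Lie subalgebra of $W_{\geq -1}$. *)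

theory Defs
  imports
    "HOL-Computational_Algebra.Computational_Algebra"
    "HOL-Library.Function_Algebras"
begin

text \<open>
  Derivations are maps \<open>'a poly \<Rightarrow> 'a poly\<close>. The additive group structure on maps is the pointwise
  one of \<^theory>\<open>HOL-Library.Function_Algebras\<close>; the pointwise product of that theory is not used.
\<close>

definition scale_map :: "'a::field \<Rightarrow> ('a poly \<Rightarrow> 'a poly) \<Rightarrow> ('a poly \<Rightarrow> 'a poly)"
  where "scale_map c D = (\<lambda>p. smult c (D p))"

global_interpretation maps: vector_space "scale_map :: 'a::field \<Rightarrow> _"
  by standard (auto simp: scale_map_def fun_eq_iff smult_add_right smult_add_left)

definition Der_poly :: "('a::field poly \<Rightarrow> 'a poly) set"
  where "Der_poly =
    {D. Vector_Spaces.linear smult smult D \<and> (\<forall>p q. D (p * q) = D p * q + p * D q)}"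

definition lie_bracket :: "('a::field poly \<Rightarrow> 'a poly) \<Rightarrow> ('a poly \<Rightarrow> 'a poly) \<Rightarrow> ('a poly \<Rightarrow> 'a poly)"
  where "lie_bracket D E = (\<lambda>p. D (E p) - E (D p))"

text \<open>\<open>vfield f\<close> is the vector field \<open>f\<partial>\<close>.\<close>

definition vfield :: "'a::field poly \<Rightarrow> ('a poly \<Rightarrow> 'a poly)"
  where "vfield f = (\<lambda>p. f * pderiv p)"

definition lie_subalgebra_Der :: "('a::field poly \<Rightarrow> 'a poly) set \<Rightarrow> bool"
  where "lie_subalgebra_Der \<gg> \<longleftrightarrow>
    \<gg> \<subseteq> Der_poly \<and> maps.subspace \<gg> \<and> (\<forall>D\<in>\<gg>. \<forall>E\<in>\<gg>. lie_bracket D E \<in> \<gg>)"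

text \<open>
  Stated through spanning sets, since \<open>maps.dim\<close> is a natural number and is no measure
  of infinite dimension.
\<close>

definition infinite_dimensional :: "('a::field poly \<Rightarrow> 'a poly) set \<Rightarrow> bool"
  where "infinite_dimensional V \<longleftrightarrow> (\<nexists>B. finite B \<and> maps.span B = V)"

lemma lie_bracket_vfield:
  "lie_bracket (vfield f) (vfield g) = vfield (f * pderiv g - pderiv f * g)"
  by (simp add: lie_bracket_def vfield_def fun_eq_iff pderiv_mult algebra_simps)

lemma Der_poly_eq_range_vfield: "(Der_poly :: ('a::field poly \<Rightarrow> 'a poly) set) = range vfield"
proof (intro equalityI subsetI)
  fix D :: "'a poly \<Rightarrow> 'a poly" assume "D \<in> Der_poly"
  then have lin: "Vector_Spaces.linear smult smult D"
    and leib: "\<And>p q. D (p * q) = D p * q + p * D q"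
    by (auto simp: Der_poly_def)
  interpret D: Vector_Spaces.linear smult smult D by (fact lin)
  have "D 1 = D 1 + D 1" using leib[of 1 1] by (simp only: mult_1_left mult_1_right)
  then have "D 1 = 0" by (metis add_cancel_right_right)
  have const: "D [:c:] = 0" for c
    using D.scale[of c 1] \<open>D 1 = 0\<close> by simp
  have "D p = D [:0, 1:] * pderiv p" for p
  proof (induction p)
    case (pCons a p)
    have "D (pCons a p) = D ([:a:] + [:0, 1:] * p)" by simp
    also have "\<dots> = D [:0, 1:] * p + [:0, 1:] * D p"
      by (simp only: D.add const leib add_0_left)
    finally show ?case by (simp add: pCons.IH pderiv_pCons algebra_simps)
  qed (simp add: D.zero)
  then show "D \<in> range vfield" by (auto simp: vfield_def)
next
  fix D :: "'a poly \<Rightarrow> 'a poly" assume "D \<in> range vfield"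
  then obtain f where D: "D = vfield f" by auto
  have "Vector_Spaces.linear smult smult D"
    by unfold_locales
      (auto simp: D vfield_def pderiv_add pderiv_smult algebra_simps smult_add_right smult_add_left)
  then show "D \<in> Der_poly"
    by (auto simp: Der_poly_def D vfield_def pderiv_mult algebra_simps)
qed

text \<open>\<open>k(t)\<close> is \<open>'a poly fract\<close>; a subfield is required to contain the constants \<open>k\<close>.\<close>

definition subfield_over_consts :: "'a::field poly fract set \<Rightarrow> bool"
  where "subfield_over_consts K \<longleftrightarrow>
    (\<forall>c. to_fract [:c:] \<in> K) \<and>
    (\<forall>x\<in>K. \<forall>y\<in>K. x + y \<in> K \<and> x - y \<in> K \<and> x * y \<in> K) \<and>
    (\<forall>x\<in>K. x \<noteq> 0 \<longrightarrow> inverse x \<in> K)"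

definition adjoin :: "'a::field poly fract set \<Rightarrow> 'a poly fract set"
  where "adjoin S = subfield_over_consts hull S"

definition ratios :: "('a::field poly \<Rightarrow> 'a poly) set \<Rightarrow> 'a poly fract set"
  where "ratios \<gg> = {Fract w u | w u. vfield w \<in> \<gg> \<and> vfield u \<in> \<gg> \<and> u \<noteq> 0}"

definition field_of_ratios :: "('a::field poly \<Rightarrow> 'a poly) set \<Rightarrow> 'a poly fract set"
  where "field_of_ratios \<gg> = adjoin (ratios \<gg>)"

definition poly_subring :: "'a::field poly \<Rightarrow> 'a poly set"
  where "poly_subring f = {pcompose p f | p. True}"

text \<open>
  \<open>min_cofactor f\<close> is \<open>g\<^sub>f\<close>, meaningful for non-constant \<open>f\<close>. It is determined up to a nonzero scalar
  only, and \<open>L_alg f\<close> does not depend on the choice.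
\<close>

definition min_cofactor :: "'a::field poly \<Rightarrow> 'a poly"
  where "min_cofactor f = (ARG_MIN degree g. g \<noteq> 0 \<and> pderiv f * g \<in> poly_subring f)"

definition L_alg :: "'a::field poly \<Rightarrow> ('a poly \<Rightarrow> 'a poly) set"
  where "L_alg f = {vfield (pcompose p f * min_cofactor f) | p. True}"

end

theory Submission
  imports Defs
begin

text \<open>
Write \<open>V = {u. u\<partial> \<in> \<gg>}\<close> for the space of coefficients, \<open>F\<close> for the field of ratios and
\<open>A = F \<inter> k[t]\<close>. Four facts combine.

\<open>F\<close> contains a non-constant polynomial. Fix \<open>u \<noteq> 0\<close> in \<open>V\<close>. Since \<open>k[t]/(u)\<close> is finite-dimensional
and \<open>V\<close> is not, infinitely many linearly independent elements of \<open>V\<close> are divisible by \<open>u\<close>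
(\<open>inf_dim_multiples\<close>), and one of them has a non-constant quotient by \<open>u\<close>
(\<open>exists_poly_in_field_of_ratios\<close>). Applied to \<open>A\<close> in place of \<open>V\<close>, the same lemma shows that every
denominator divides a nonzero element of \<open>A\<close>, so that \<open>F\<close> is the fraction field of \<open>A\<close>
(\<open>subfield_elem_eq_quotient\<close>).

\<open>A = k[f]\<close> for some \<open>f\<close> (\<open>generated_by_one_polynomial\<close>). This is the polynomial case of Lueroth's
theorem. Let \<open>P(X,t)\<close> be the minimal polynomial of \<open>t\<close> over \<open>F\<close>, scaled to be primitive over
\<open>k[t]\<close>. For every \<open>h \<in> A\<close> the difference \<open>h(X) - h(t)\<close> vanishes at \<open>X = t\<close>, so that \<open>P\<close> divides it,
over \<open>k[t]\<close> by Gauss's lemma. Hence the leading coefficient of \<open>P\<close> is a constant and all coefficients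
of \<open>P\<close> lie in \<open>A\<close>. One of them, \<open>f\<close>, is not constant. Counting degrees in \<open>t\<close> in
\<open>f(X) - f(t) = P S\<close> shows that \<open>S\<close> is a constant, so that \<open>f(X) - f(t)\<close> divides \<open>h(X) - h(t)\<close> for
all \<open>h \<in> A\<close>. At \<open>X = 0\<close> this says that \<open>f - f(0)\<close> divides \<open>h - h(0)\<close>. The quotient is again in \<open>A\<close>
and has smaller degree, and induction gives \<open>h \<in> k[f]\<close>.

Every \<open>u \<in> V\<close> differentiates \<open>F\<close>, that is \<open>u F' \<subseteq> F\<close>
(\<open>derivation_preserves_field_of_ratios\<close>). By the quotient rule this need only be seen on ratios \<open>w/v\<close>,
where \<open>u (w/v)' = ((v w' - v' w)/v) (u/v)\<close> is a product of two ratios because \<open>V\<close> is closed under the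
bracket.

Consequently \<open>u f' \<in> F \<inter> k[t] = k[f]\<close> for all \<open>u \<in> V\<close>, and division with remainder in \<open>k[f]\<close> shows
that every such \<open>u\<close> is a multiple of the minimal cofactor by an element of \<open>k[f]\<close>
(\<open>multiple_of_min_cofactor\<close>).
\<close>

section \<open>Finite-dimensional spaces of polynomials\<close>

global_interpretation polys: vector_space "smult :: 'a::field \<Rightarrow> 'a poly \<Rightarrow> 'a poly"
  by standard (auto simp: smult_add_right smult_add_left)

text \<open>
Containment in a finite span, rather than equality with one, makes the property pass to arbitrary
subsets.
\<close>

definition fin_dim :: "'a::field poly set \<Rightarrow> bool"
  where "fin_dim V \<longleftrightarrow> (\<exists>B. finite B \<and> V \<subseteq> polys.span B)"

lemma fin_dim_subset: "fin_dim W \<Longrightarrow> V \<subseteq> W \<Longrightarrow> fin_dim V"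
  unfolding fin_dim_def by blast

lemma fin_dim_subspace_basis:
  assumes "fin_dim V" "polys.subspace V"
  obtains B where "finite B" "B \<subseteq> V" "polys.span B = V"
proof -
  obtain T where T: "finite T" "V \<subseteq> polys.span T" using assms by (auto simp: fin_dim_def)
  obtain B where B: "B \<subseteq> V" "polys.independent B" "V \<subseteq> polys.span B"
    using polys.basis_exists by metis
  have "finite B" using polys.independent_span_bound[OF T(1) B(2)] B(1) T(2) by blast
  moreover have "polys.span B = V" using polys.span_subspace[OF B(1,3) assms(2)] .
  ultimately show ?thesis using that B(1) by blast
qed

lemma fin_dim_degree_less: "fin_dim {p. p = 0 \<or> degree p < n}"
proof -
  have "p \<in> polys.span (monom 1 ` {..<n})" if "p = 0 \<or> degree p < n" for p :: "'a poly"
  proof (cases "p = 0")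
    case True
    then show ?thesis using polys.span_zero by simp
  next
    case False
    have "p = (\<Sum>i\<le>degree p. smult (coeff p i) (monom 1 i))"
      using poly_as_sum_of_monoms[of p] by (simp add: smult_monom)
    also have "\<dots> \<in> polys.span (monom 1 ` {..<n})"
      using that False by (intro polys.span_sum polys.span_scale polys.span_base) auto
    finally show ?thesis .
  qed
  then show ?thesis unfolding fin_dim_def by (intro exI[of _ "monom 1 ` {..<n}"]) auto
qed

lemma fin_dim_imp_degree_bounded:
  assumes "fin_dim V"
  obtains n where "\<And>p. p \<in> V \<Longrightarrow> degree p \<le> n"
proof -
  obtain B where B: "finite B" "V \<subseteq> polys.span B" using assms by (auto simp: fin_dim_def)
  define n where "n = Max (insert 0 (degree ` B))"
  have "polys.subspace {p. degree p \<le> n}"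
    by (auto simp: polys.subspace_def intro: degree_add_le order_trans[OF degree_smult_le])
  moreover have "B \<subseteq> {p. degree p \<le> n}" using B(1) by (auto simp: n_def)
  ultimately have "polys.span B \<subseteq> {p. degree p \<le> n}" by (rule polys.span_minimal[rotated])
  then show ?thesis using that B(2) by blast
qed

text \<open>
The multiples of \<open>b\<close> in \<open>V\<close> form the kernel of reduction modulo \<open>b\<close>, whose image has dimension at
most \<open>degree b\<close>.
\<close>

lemma inf_dim_multiples:
  assumes V: "polys.subspace V" "\<not> fin_dim V" and "b \<noteq> 0"
  shows "\<not> fin_dim (V \<inter> {p. b dvd p})"
proof
  assume "fin_dim (V \<inter> {p. b dvd p})"
  then obtain B where B: "finite B" "V \<inter> {p. b dvd p} \<subseteq> polys.span B"
    by (auto simp: fin_dim_def)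
  define M where "M p = p mod b" for p
  interpret M: module_hom smult smult M
    by unfold_locales (auto simp: M_def poly_mod_add_left mod_smult_left smult_add_right smult_add_left)
  have "M ` V \<subseteq> {p. p = 0 \<or> degree p < degree b}"
    using degree_mod_less[OF \<open>b \<noteq> 0\<close>] by (auto simp: M_def)
  then have "fin_dim (M ` V)" using fin_dim_degree_less fin_dim_subset by blast
  moreover have "polys.subspace (M ` V)" using V(1) by (rule M.subspace_image)
  ultimately obtain D where D: "finite D" "D \<subseteq> M ` V" "polys.span D = M ` V"
    by (rule fin_dim_subspace_basis)
  then obtain C where C: "finite C" "C \<subseteq> V" "D = M ` C"
    using finite_subset_image[OF D(1,2)] by blast
  have "V \<subseteq> polys.span (B \<union> C)"
  proof
    fix w assume w: "w \<in> V"
    then have "M w \<in> M ` polys.span C" using D(3) C(3) by (auto simp: M.span_image)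
    then obtain c where c: "c \<in> polys.span C" "M w = M c" by auto
    have "c \<in> V" using c(1) C(2) V(1) polys.span_minimal by blast
    then have "w - c \<in> V \<inter> {p. b dvd p}"
      using w c(2) V(1) by (auto simp: M_def mod_eq_dvd_iff polys.subspace_diff)
    then have "w - c \<in> polys.span (B \<union> C)" using B(2) polys.span_mono[of B "B \<union> C"] by auto
    moreover have "c \<in> polys.span (B \<union> C)" using c(1) polys.span_mono[of C "B \<union> C"] by auto
    ultimately have "(w - c) + c \<in> polys.span (B \<union> C)" by (rule polys.span_add)
    then show "w \<in> polys.span (B \<union> C)" by simp
  qed
  then show False using V(2) B(1) C(1) by (auto simp: fin_dim_def intro!: exI[of _ "B \<union> C"])
qed

section \<open>Primitive polynomials over a univariate polynomial ring\<close>

text \<open>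
Gauss's lemma, by cancelling one irreducible factor \<open>d\<close> of \<open>c\<close> at a time: a constant polynomial
\<open>[:d:]\<close> with \<open>d\<close> prime is again prime. Primitivity is expressed by divisors, since an arbitrary field
carries no gcd operation from which to form a content.
\<close>

lemma primitive_dvd_smultD:
  fixes Q H :: "'a::field poly poly"
  assumes prim: "\<And>c. [:c:] dvd Q \<Longrightarrow> is_unit c"
  assumes "c \<noteq> 0" and "Q dvd smult c H"
  shows "Q dvd H"
  using assms(2,3)
proof (induction "degree c" arbitrary: c rule: less_induct)
  case less
  show ?case
  proof (cases "is_unit c")
    case True
    then obtain d where d: "d * c = 1" by (metis dvdE mult.commute)
    have "Q dvd smult d (smult c H)" using less.prems(2) by (rule dvd_smult)
    then show ?thesis using d by simp
  next
    case False
    define D where "D = {d. d dvd c \<and> degree d > 0}"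
    have "degree c > 0" using False less.prems by (simp add: is_unit_iff_degree)
    then have "c \<in> D" by (simp add: D_def)
    then obtain d where d: "d \<in> D" and dmin: "\<And>e. e \<in> D \<Longrightarrow> degree d \<le> degree e"
      using ex_has_least_nat[of "\<lambda>x. x \<in> D" c degree] by blast
    have "d \<noteq> 0" using d by (auto simp: D_def)
    have "irreducible d"
    proof (rule irreducibleI)
      show "d \<noteq> 0" by fact
      show "\<not> is_unit d" using d \<open>d \<noteq> 0\<close> by (auto simp: D_def is_unit_iff_degree)
      fix a b assume ab: "d = a * b"
      then have nz: "a \<noteq> 0" "b \<noteq> 0" using \<open>d \<noteq> 0\<close> by auto
      have "degree d = degree a + degree b" using ab nz by (simp add: degree_mult_eq)
      moreover have "a dvd c" using ab d by (auto simp: D_def dest: dvd_mult_left)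
      ultimately show "is_unit a \<or> is_unit b"
        using dmin[of a] nz by (cases "degree a > 0") (auto simp: D_def is_unit_iff_degree)
    qed
    then have pr: "prime_elem [:d:]"
      by (simp add: field_poly_irreducible_imp_prime prime_elem_const_poly_iff)
    obtain c' where c': "c = d * c'" using d by (auto simp: D_def)
    obtain S where S: "smult c H = Q * S" using less.prems by (auto elim: dvdE)
    have "[:d:] dvd Q * S" unfolding S[symmetric] c' by (rule dvdI[of _ _ "smult c' H"]) (simp add: mult.commute)
    moreover have "\<not> [:d:] dvd Q"
      using prim[of d] d \<open>d \<noteq> 0\<close> by (auto simp: D_def is_unit_iff_degree)
    ultimately have "[:d:] dvd S" using pr prime_elem_dvd_multD by blast
    then obtain S' where "S = [:d:] * S'" by (auto elim: dvdE)
    then have "smult d (smult c' H) = smult d (Q * S')" using S c' by simp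
    then have "smult d (smult c' H - Q * S') = 0" by (simp add: smult_diff_right)
    then have "smult c' H = Q * S'" using \<open>d \<noteq> 0\<close> unfolding smult_eq_0_iff by simp
    then have "Q dvd smult c' H" by simp
    moreover have "c' \<noteq> 0" "degree c' < degree c"
      using c' less.prems d by (auto simp: D_def degree_mult_eq)
    ultimately show ?thesis using less.hyps by blast
  qed
qed

section \<open>Separating the two variables\<close>

text \<open>
An element of \<open>k[t][X]\<close> is regarded here as a polynomial in \<open>t\<close> over \<open>k[X]\<close>, and \<open>top_coeffs d P\<close> is
the coefficient of \<open>t ^ d\<close>.
\<close>

definition top_coeffs :: "nat \<Rightarrow> 'a::field poly poly \<Rightarrow> 'a poly"
  where "top_coeffs d P = map_poly (\<lambda>p. coeff p d) P"

lemma coeff_top_coeffs: "coeff (top_coeffs d P) i = coeff (coeff P i) d"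
  by (simp add: top_coeffs_def coeff_map_poly)

lemma coeff_mult_degree_le:
  fixes p q :: "'a::field poly"
  assumes "degree p \<le> d" "degree q \<le> e"
  shows "coeff (p * q) (d + e) = coeff p d * coeff q e"
proof -
  have "coeff p i * coeff q (d + e - i) = (if i = d then coeff p d * coeff q e else 0)"
    if "i \<le> d + e" for i
  proof -
    have "i > d \<Longrightarrow> coeff p i = 0" using assms by (simp add: coeff_eq_0)
    moreover have "i < d \<Longrightarrow> coeff q (d + e - i) = 0" using assms by (intro coeff_eq_0) auto
    ultimately show ?thesis by (cases i d rule: linorder_cases) auto
  qed
  then show ?thesis by (simp add: coeff_mult)
qed

text \<open>
If \<open>d\<close> and \<open>e\<close> are the degrees in \<open>t\<close>, this is multiplicativity of leading coefficients, and hence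
additivity of the degree in \<open>t\<close>.
\<close>

lemma top_coeffs_mult:
  assumes "\<And>i. degree (coeff P i) \<le> d" "\<And>i. degree (coeff S i) \<le> e"
  shows "top_coeffs (d + e) (P * S) = top_coeffs d P * top_coeffs e S"
proof (rule poly_eqI)
  fix n
  have "coeff (top_coeffs (d + e) (P * S)) n = (\<Sum>i\<le>n. coeff (coeff P i * coeff S (n - i)) (d + e))"
    by (simp only: coeff_top_coeffs coeff_mult[of P S] coeff_sum)
  also have "\<dots> = (\<Sum>i\<le>n. coeff (coeff P i) d * coeff (coeff S (n - i)) e)"
    by (intro sum.cong refl coeff_mult_degree_le assms)
  also have "\<dots> = coeff (top_coeffs d P * top_coeffs e S) n"
    by (simp only: coeff_top_coeffs coeff_mult)
  finally show "coeff (top_coeffs (d + e) (P * S)) n = coeff (top_coeffs d P * top_coeffs e S) n" .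
qed

lemma exists_top_degree:
  fixes P :: "'a::field poly poly"
  obtains d where "\<And>j. degree (coeff P j) \<le> d" "P \<noteq> 0 \<Longrightarrow> top_coeffs d P \<noteq> 0"
proof -
  define h where "h i = degree (coeff P i)" for i
  have "h i \<le> Max (h ` {..degree P})" for i
    by (cases "i \<le> degree P") (auto simp: h_def coeff_eq_0)
  moreover obtain i where "Max (h ` {..degree P}) = h i"
    using Max_in[of "h ` {..degree P}"] by blast
  ultimately have i: "\<And>j. degree (coeff P j) \<le> degree (coeff P i)"
    by (simp add: h_def)
  have "top_coeffs (degree (coeff P i)) P \<noteq> 0" if nz: "P \<noteq> 0"
  proof (cases "degree (coeff P i) = 0")
    case True
    obtain j where "coeff P j \<noteq> 0" using nz by (metis leading_coeff_0_iff)
    then have "coeff (coeff P j) 0 \<noteq> 0" using True i[of j] by (metis le_zero_eq leading_coeff_0_iff)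
    then show ?thesis using True by (metis coeff_0 coeff_top_coeffs)
  next
    case False
    then have "coeff (coeff P i) (degree (coeff P i)) \<noteq> 0" by auto
    then show ?thesis by (metis coeff_0 coeff_top_coeffs)
  qed
  then show ?thesis using that i by blast
qed

text \<open>
The polynomial \<open>h(X) - h(t)\<close> in \<open>k[t][X]\<close>.
\<close>

definition var_diff :: "'a::field poly \<Rightarrow> 'a poly poly"
  where "var_diff h = map_poly (\<lambda>c. [:c:]) h - [:h:]"

lemma coeff_var_diff: "coeff (var_diff h) i = [:coeff h i:] - (if i = 0 then h else 0)"
  by (simp add: var_diff_def coeff_map_poly coeff_pCons split: nat.split)

lemma poly_map_const: "poly (map_poly (\<lambda>c. [:c:]) h) x = pcompose h x"
  for h :: "'a::field poly"
  by (induction h) (simp_all add: map_poly_pCons pcompose_pCons)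

lemma poly_var_diff_at_const: "poly (var_diff h) 0 = [:poly h 0:] - h"
  by (simp add: var_diff_def poly_map_const poly_0_coeff_0 coeff_map_poly)

lemma poly_var_diff_at_var: "poly (var_diff h) [:0, 1:] = 0"
  by (simp add: var_diff_def poly_map_const)

lemma
  assumes "degree h > 0"
  shows degree_var_diff: "degree (var_diff h) = degree h"
    and lead_coeff_var_diff: "lead_coeff (var_diff h) = [:lead_coeff h:]"
proof -
  show "degree (var_diff h) = degree h"
    using assms by (intro antisym degree_le le_degree) (auto simp: coeff_var_diff coeff_eq_0)
  then show "lead_coeff (var_diff h) = [:lead_coeff h:]"
    using assms by (simp add: coeff_var_diff)
qed

text \<open>
The degree of \<open>P\<close> in \<open>t\<close> is at least that of \<open>f(X) - f(t)\<close>, so nothing is left for \<open>S\<close>, which therefore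
lies in \<open>k[X]\<close>. The leading coefficient of \<open>f(X) - f(t)\<close> with respect to \<open>t\<close> is a constant and is
divisible by \<open>S\<close>, so \<open>S\<close> does not involve \<open>X\<close> either.
\<close>

lemma full_height_factor_of_var_diff:
  assumes f: "degree f > 0" and fac: "var_diff f = P * S"
    and P: "degree (coeff P i) \<ge> degree f"
  shows "degree S = 0"
proof -
  have nz: "var_diff f \<noteq> 0" using f degree_var_diff[OF f] by auto
  obtain d where d: "\<And>j. degree (coeff P j) \<le> d" "top_coeffs d P \<noteq> 0"
    using exists_top_degree[of P] nz fac by (metis mult_zero_left)
  obtain e where e: "\<And>j. degree (coeff S j) \<le> e" "top_coeffs e S \<noteq> 0"
    using exists_top_degree[of S] nz fac by (metis mult_zero_right)
  have prod: "top_coeffs (d + e) (var_diff f) = top_coeffs d P * top_coeffs e S"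
    using top_coeffs_mult[of P d S e] d e fac by simp
  have "d \<ge> degree f" using d(1)[of i] P by linarith
  with f have top: "coeff (top_coeffs (d + e) (var_diff f)) l = (if l = 0 then - coeff f (d + e) else 0)" for l
    by (auto simp: coeff_top_coeffs coeff_var_diff coeff_pCons split: nat.split)
  have "top_coeffs (d + e) (var_diff f) \<noteq> 0" using prod d e by simp
  then have "coeff f (d + e) \<noteq> 0"
    using top by (metis (full_types) neg_equal_0_iff_equal poly_eqI coeff_0)
  then have "d + e \<le> degree f" by (rule le_degree)
  with \<open>d \<ge> degree f\<close> have "e = 0" by simp
  have "degree (top_coeffs d P * top_coeffs e S) = 0"
    unfolding prod[symmetric] using degree_le[of 0 "top_coeffs (d + e) (var_diff f)"] by (simp add: top)
  then have "degree (top_coeffs 0 S) = 0"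
    using d e \<open>e = 0\<close> by (simp add: degree_mult_eq)
  have "coeff S j = 0" if "j > 0" for j
  proof -
    have "coeff (coeff S j) 0 = 0"
      using \<open>degree (top_coeffs 0 S) = 0\<close> that by (metis coeff_top_coeffs coeff_eq_0)
    moreover have "degree (coeff S j) = 0" using e(1)[of j] \<open>e = 0\<close> by simp
    ultimately show ?thesis by (metis leading_coeff_0_iff)
  qed
  then show ?thesis by (metis gr0I leading_coeff_0_iff degree_0)
qed

section \<open>Lueroth's theorem for rings of polynomials\<close>

text \<open>
The rings \<open>F \<inter> k[t]\<close> with \<open>F\<close> a field between \<open>k\<close> and \<open>k(t)\<close> have these properties. Closure under
exact division is what excludes rings such as \<open>k[t\<^sup>2, t\<^sup>3]\<close>.
\<close>

locale division_closed_subring =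
  fixes A :: "'a::field poly set"
  assumes const: "[:c:] \<in> A"
    and add: "a \<in> A \<Longrightarrow> b \<in> A \<Longrightarrow> a + b \<in> A"
    and mult: "a \<in> A \<Longrightarrow> b \<in> A \<Longrightarrow> a * b \<in> A"
    and quotient: "b * q \<in> A \<Longrightarrow> b \<in> A \<Longrightarrow> b \<noteq> 0 \<Longrightarrow> q \<in> A"
begin

lemma zero: "0 \<in> A" using const[of 0] by simp

lemma diff: "a \<in> A \<Longrightarrow> b \<in> A \<Longrightarrow> a - b \<in> A"
  using add[of a "[:-1:] * b"] mult[of "[:-1:]" b] const[of "-1"] by simp

lemma poly_subring_subset:
  assumes "f \<in> A"
  shows "poly_subring f \<subseteq> A"
proof -
  have "pcompose p f \<in> A" for p
    by (induction p) (auto simp: pcompose_pCons zero intro!: add const mult assms)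
  then show ?thesis by (auto simp: poly_subring_def)
qed

text \<open>The algebraic relations of \<open>t\<close> over \<open>A\<close>; as a coefficient, \<open>t\<close> is \<open>[:0, 1:]\<close>.\<close>

definition relations :: "'a poly poly set"
  where "relations = {H. (\<forall>i. coeff H i \<in> A) \<and> poly H [:0, 1:] = 0}"

lemma var_diff_in_relations: "h \<in> A \<Longrightarrow> var_diff h \<in> relations"
  by (auto simp: relations_def coeff_var_diff poly_var_diff_at_var intro!: diff const zero)

text \<open>
Division by \<open>Q\<close> over the fraction field of \<open>A\<close>, with the denominators collected in \<open>c\<close>. Each step
cancels the leading term of \<open>H\<close> and leaves a relation, so that by minimality of \<open>Q\<close> the process can
only stop at zero.
\<close>

lemma minimal_relation_dvd:
  assumes Q: "Q \<in> relations" "Q \<noteq> 0"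
    and min: "\<And>H. H \<in> relations \<Longrightarrow> H \<noteq> 0 \<Longrightarrow> degree Q \<le> degree H"
    and "H \<in> relations"
  shows "\<exists>c. c \<noteq> 0 \<and> Q dvd smult c H"
  using \<open>H \<in> relations\<close>
proof (induction "degree H" arbitrary: H rule: less_induct)
  case less
  show ?case
  proof (cases "H = 0")
    case True
    then show ?thesis by (intro exI[of _ 1]) simp
  next
    case False
    define k where "k = degree H - degree Q"
    define R where "R = smult (lead_coeff Q) H - smult (lead_coeff H) (monom 1 k * Q)"
    have le: "degree Q \<le> degree H" using min less.prems False by blast
    have R: "R \<in> relations"
      using Q less.prems
      by (auto simp: relations_def R_def coeff_monom_mult intro!: diff mult zero)
    have "degree R < degree H \<or> R = 0"
    proof (cases "R = 0")
      case False
      have "degree R \<le> degree H"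
        unfolding R_def using le Q
        by (intro degree_diff_le order_trans[OF degree_smult_le])
          (auto simp: k_def degree_mult_eq degree_monom_eq)
      moreover have "coeff (monom 1 k * Q) (degree H) = lead_coeff Q"
        using le by (simp add: coeff_monom_mult k_def)
      then have "coeff R (degree H) = 0"
        by (simp add: R_def)
      ultimately show ?thesis using False by (metis le_neq_implies_less leading_coeff_0_iff)
    qed simp
    then obtain c where c: "c \<noteq> 0" "Q dvd smult c R"
      using less.hyps[OF _ R] by (metis dvd_0_right one_neq_zero smult_0_right)
    have "smult (c * lead_coeff Q) H = smult c R + Q * smult (c * lead_coeff H) (monom 1 k)"
      by (simp add: R_def smult_diff_right mult.commute)
    then have "Q dvd smult (c * lead_coeff Q) H"
      by (simp only:) (intro dvd_add c(2) dvd_triv_left)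
    moreover have "c * lead_coeff Q \<noteq> 0" using c Q by simp
    ultimately show ?thesis by blast
  qed
qed

text \<open>
\<open>P\<close> is the minimal polynomial of \<open>t\<close> over the fraction field of \<open>A\<close>, up to a factor that makes it
primitive over \<open>k[t]\<close>. Dividing out the content may move the coefficients out of \<open>A\<close>, but only by the
common factor \<open>c\<close>.
\<close>

lemma exists_primitive_minimal_relation:
  assumes "f\<^sub>0 \<in> A" "degree f\<^sub>0 > 0"
  obtains c P where "c \<noteq> 0" "smult c P \<in> relations" "P \<noteq> 0"
    "\<forall>H\<in>relations. P dvd H"
proof -
  have nz: "var_diff f\<^sub>0 \<noteq> 0" using degree_var_diff[OF assms(2)] assms(2) by auto
  obtain Q where Q: "Q \<in> relations" "Q \<noteq> 0"
    and min: "\<And>H. H \<in> relations \<Longrightarrow> H \<noteq> 0 \<Longrightarrow> degree Q \<le> degree H"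
    using ex_has_least_nat[of "\<lambda>H. H \<in> relations \<and> H \<noteq> 0" "var_diff f\<^sub>0" degree]
      var_diff_in_relations[OF assms(1)] nz by blast
  \<comment> \<open>Among the scaled relations of minimal degree, one whose leading coefficient has least degree
      in \<open>t\<close> is primitive.\<close>
  define J where "J = {P. P \<noteq> 0 \<and> degree P = degree Q \<and> (\<exists>c. c \<noteq> 0 \<and> smult c P \<in> relations)}"
  have "Q \<in> J" using Q by (auto simp: J_def intro!: exI[of _ 1])
  then obtain P where P: "P \<in> J"
    and Pmin: "\<And>P'. P' \<in> J \<Longrightarrow> degree (lead_coeff P) \<le> degree (lead_coeff P')"
    using ex_has_least_nat[of "\<lambda>P. P \<in> J" Q "\<lambda>P. degree (lead_coeff P)"] by blast
  from P obtain c where c: "c \<noteq> 0" "smult c P \<in> relations" by (auto simp: J_def)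
  have prim: "is_unit d" if "[:d:] dvd P" for d
  proof -
    obtain P' where "P = [:d:] * P'" using \<open>[:d:] dvd P\<close> by (rule dvdE)
    then have P': "P = smult d P'" by simp
    then have nz: "d \<noteq> 0" "P' \<noteq> 0" using P by (auto simp: J_def)
    have "P' \<in> J" using P c P' nz by (auto simp: J_def intro!: exI[of _ "c * d"])
    then have "degree d = 0" using Pmin[of P'] nz by (simp add: P' degree_mult_eq)
    then show ?thesis using nz by (simp add: is_unit_iff_degree)
  qed
  have "P dvd H" if H: "H \<in> relations" for H
  proof -
    have "degree (smult c P) = degree Q" using P c by (auto simp: J_def)
    then obtain d where d: "d \<noteq> 0" "smult c P dvd smult d H"
      using minimal_relation_dvd[of "smult c P" H] c P H min by (auto simp: J_def)
    then have "P dvd smult d H" by (metis dvd_smult dvd_refl dvd_trans)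
    then show ?thesis using primitive_dvd_smultD[of P d H] prim d by blast
  qed
  then show ?thesis using that c P by (auto simp: J_def)
qed

text \<open>
The polynomial case of Lueroth's theorem: the generator is a non-constant coefficient of the minimal
polynomial of \<open>t\<close>.
\<close>

theorem generated_by_one_polynomial:
  assumes f\<^sub>0: "f\<^sub>0 \<in> A" "degree f\<^sub>0 > 0"
  shows "\<exists>f. degree f > 0 \<and> A = poly_subring f"
proof -
  obtain c P where c: "c \<noteq> 0" "smult c P \<in> relations" and "P \<noteq> 0"
    and dvd: "\<forall>H\<in>relations. P dvd H"
    by (rule exists_primitive_minimal_relation[OF f\<^sub>0])
  have vd: "P dvd var_diff h" if "h \<in> A" for h
    using dvd var_diff_in_relations that by blast
  obtain S\<^sub>0 where "var_diff f\<^sub>0 = P * S\<^sub>0" using vd[OF f\<^sub>0(1)] by (rule dvdE)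
  then have "[:lead_coeff f\<^sub>0:] = lead_coeff P * lead_coeff S\<^sub>0"
    using lead_coeff_var_diff[OF f\<^sub>0(2)] by (simp only: lead_coeff_mult)
  then have "lead_coeff P dvd [:lead_coeff f\<^sub>0:]" by (rule dvdI)
  moreover have "is_unit [:lead_coeff f\<^sub>0:]" using f\<^sub>0(2) by (auto simp: is_unit_pCons_iff)
  ultimately have "is_unit (lead_coeff P)" using dvd_trans by blast
  then obtain l where l: "lead_coeff P = [:l:]"
    by (elim is_unit_polyE)
  with \<open>P \<noteq> 0\<close> have "l \<noteq> 0" by auto
  have cA: "c * coeff P i \<in> A" for i using c by (auto simp: relations_def)
  \<comment> \<open>The leading coefficient of \<open>smult c P\<close> is \<open>c\<close> times the constant \<open>l\<close>.\<close>
  have "c \<in> A"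
  proof -
    have "[:inverse l:] * (c * [:l:]) \<in> A" using mult[OF const cA[of "degree P"]] unfolding l .
    then show ?thesis using \<open>l \<noteq> 0\<close> by simp
  qed
  then have PA: "coeff P i \<in> A" for i using quotient[of c "coeff P i"] cA c by blast
  \<comment> \<open>Otherwise \<open>P\<close> would be an algebraic relation for \<open>t\<close> over \<open>k\<close>.\<close>
  have "\<exists>i. degree (coeff P i) > 0"
  proof (rule ccontr)
    assume "\<not> ?thesis"
    then have "coeff P i = [:coeff (coeff P i) 0:]" for i
      by (intro degree_0_id[symmetric]) simp
    moreover define r where "r = map_poly (\<lambda>p. coeff p 0) P"
    ultimately have P: "P = map_poly (\<lambda>c. [:c:]) r"
      by (intro poly_eqI) (simp add: coeff_map_poly)
    have "poly P [:0, 1:] = 0" using c by (auto simp: relations_def)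
    then have "r = 0" by (simp add: P poly_map_const)
    with P \<open>P \<noteq> 0\<close> show False by simp
  qed
  then obtain i where i: "degree (coeff P i) > 0" by blast
  define f where "f = coeff P i"
  have f: "f \<in> A" "degree f > 0" using PA i by (auto simp: f_def)
  obtain S where S: "var_diff f = P * S" using vd[OF f(1)] by (rule dvdE)
  have "degree S = 0"
    using full_height_factor_of_var_diff[OF f(2) S, of i] by (simp add: f_def)
  then obtain s where s: "S = [:s:]" using degree_eq_zeroE by blast
  have "s * [:l:] = [:lead_coeff f:]"
    using lead_coeff_var_diff[OF f(2)] unfolding S lead_coeff_mult l s by (simp add: mult.commute)
  then have "s dvd [:lead_coeff f:]" by (rule dvdI[OF sym])
  moreover have "is_unit [:lead_coeff f:]" using f(2) by (auto simp: is_unit_pCons_iff)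
  ultimately have "is_unit s" using dvd_trans by blast
  then have "is_unit S" by (simp add: s is_unit_const_poly_iff)
  then have vdf: "var_diff f dvd var_diff h" if "h \<in> A" for h
    using vd[OF that] by (simp add: S mult_unit_dvd_iff)
  \<comment> \<open>Evaluation at \<open>X = 0\<close> leaves a divisibility in \<open>k[t]\<close>.\<close>
  have key: "f - [:poly f 0:] dvd h - [:poly h 0:]" if h: "h \<in> A" for h
  proof -
    obtain R where "var_diff h = var_diff f * R" using vdf[OF h] by (rule dvdE)
    then have "poly (var_diff h) 0 = poly (var_diff f) 0 * poly R 0" by simp
    then have "- poly (var_diff h) 0 = - poly (var_diff f) 0 * poly R 0" by simp
    then have "h - [:poly h 0:] = (f - [:poly f 0:]) * poly R 0"
      by (simp only: poly_var_diff_at_const minus_diff_eq)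
    then show ?thesis by (rule dvdI)
  qed
  have "h \<in> poly_subring f" if "h \<in> A" for h
    using that
  proof (induction "degree h" arbitrary: h rule: less_induct)
    case less
    obtain q where q: "h - [:poly h 0:] = (f - [:poly f 0:]) * q"
      using key[OF less.prems] by (rule dvdE)
    have fm: "degree (f - [:poly f 0:]) = degree f"
      using degree_add_eq_left[of "- [:poly f 0:]" f] f(2)
      unfolding diff_conv_add_uminus by simp
    then have fnz: "f - [:poly f 0:] \<noteq> 0" using f(2) by force
    have "q \<in> A"
      by (rule quotient[of "f - [:poly f 0:]"])
        (simp_all only: q[symmetric] diff[OF f(1) const] diff[OF less.prems const] fnz not_False_eq_True)
    have h: "h = [:poly h 0:] + (f - [:poly f 0:]) * q" using q by (simp add: algebra_simps)
    show ?case
    proof (cases "q = 0")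
      case True
      then have "h = pcompose [:poly h 0:] f" using h by (simp only: pcompose_const) simp
      then show ?thesis unfolding poly_subring_def by blast
    next
      case False
      then have "degree (h - [:poly h 0:]) = degree f + degree q"
        using q fnz fm by (simp add: degree_mult_eq)
      moreover have "degree (h - [:poly h 0:]) \<le> degree h"
        by (intro degree_diff_le) auto
      ultimately have "degree q < degree h" using f(2) by linarith
      then obtain p where p: "q = pcompose p f"
        using less.hyps \<open>q \<in> A\<close> by (auto simp: poly_subring_def)
      have var: "pcompose [:0, 1:] f = f" by (simp add: pcompose_pCons)
      have "h = pcompose ([:poly h 0:] + ([:0, 1:] - [:poly f 0:]) * p) f"
        using h unfolding p pcompose_add pcompose_mult pcompose_diff pcompose_const var .
      then show ?thesis unfolding poly_subring_def by blast
    qed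
  qed
  then show ?thesis using f poly_subring_subset by blast
qed

end

section \<open>Intermediate fields and their polynomials\<close>

lemma subfield_over_consts_adjoin: "subfield_over_consts (adjoin S)"
  unfolding adjoin_def
  by (rule hull_in) (fastforce simp: subfield_over_consts_def)

lemma subset_adjoin: "S \<subseteq> adjoin S"
  unfolding adjoin_def by (rule hull_subset)

lemma adjoin_minimal: "S \<subseteq> K \<Longrightarrow> subfield_over_consts K \<Longrightarrow> adjoin S \<subseteq> K"
  unfolding adjoin_def by (rule hull_minimal)

lemma subfield_divide:
  "subfield_over_consts K \<Longrightarrow> x \<in> K \<Longrightarrow> y \<in> K \<Longrightarrow> y \<noteq> 0 \<Longrightarrow> x / y \<in> K"
  unfolding subfield_over_consts_def by (simp add: divide_inverse)

lemma division_closed_subring_polys: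
  assumes K: "subfield_over_consts K"
  shows "division_closed_subring {p. to_fract p \<in> K}"
proof
  fix b q assume bq: "b * q \<in> {p. to_fract p \<in> K}" "b \<in> {p. to_fract p \<in> K}" "b \<noteq> 0"
  then have "to_fract (b * q) / to_fract b \<in> K"
    by (intro subfield_divide[OF K]) auto
  then show "q \<in> {p. to_fract p \<in> K}" using bq(3) by simp
qed (use K in \<open>auto simp: subfield_over_consts_def\<close>)

text \<open>
The field is the fraction field of its polynomials. The ring \<open>A\<close> of these polynomials contains all
powers of \<open>f\<close>, hence has infinite dimension, hence contains a nonzero multiple of the denominator of
\<open>x\<close>.
\<close>

lemma subfield_elem_eq_quotient:
  assumes K: "subfield_over_consts K" and f: "to_fract f \<in> K" "degree f > 0" and x: "x \<in> K"
  obtains a b where "to_fract a \<in> K" "to_fract b \<in> K" "b \<noteq> 0" "x = Fract a b"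
proof -
  let ?A = "{p. to_fract p \<in> K}"
  interpret division_closed_subring ?A using K by (rule division_closed_subring_polys)
  have sub: "polys.subspace ?A"
    using zero add mult[OF const] by (auto simp: polys.subspace_def)
  have pow: "f ^ n \<in> ?A" for n
    using f(1) const[of 1] by (induction n) (auto intro: mult[simplified] simp: one_pCons)
  have "\<not> fin_dim ?A"
  proof
    assume "fin_dim ?A"
    then obtain n where n: "\<And>p. p \<in> ?A \<Longrightarrow> degree p \<le> n" using fin_dim_imp_degree_bounded by blast
    have "degree (f ^ Suc n) = Suc n * degree f" by (rule degree_power_eq) (use f in auto)
    then show False using n[OF pow[of "Suc n"]] f(2) by (cases "degree f") auto
  qed
  obtain c d where cd: "x = Fract c d" "d \<noteq> 0" by (cases x) 
  have "\<exists>b. b \<in> ?A \<and> d dvd b \<and> b \<noteq> 0"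
  proof (rule ccontr)
    assume "\<not> ?thesis"
    then have "?A \<inter> {p. d dvd p} \<subseteq> polys.span {}" by auto
    then have "fin_dim (?A \<inter> {p. d dvd p})" unfolding fin_dim_def by blast
    then show False using inf_dim_multiples[OF sub \<open>\<not> fin_dim ?A\<close> cd(2)] by blast
  qed
  then obtain e where e: "to_fract (d * e) \<in> K" "d * e \<noteq> 0" by (auto elim!: dvdE)
  have xe: "x = Fract (c * e) (d * e)" using cd e by (simp add: mult_fract_cancel mult.commute eq_fract)
  have "x * to_fract (d * e) \<in> K" using x e(1) K unfolding subfield_over_consts_def by blast
  moreover have "x * to_fract (d * e) = to_fract (c * e)"
    using e(2) by (simp add: xe Fract_conv_to_fract)
  ultimately show ?thesis using that e xe by metis
qed

section \<open>The space of coefficients of a Lie algebra of vector fields\<close>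

lemma vfield_smult: "vfield (smult c f) = scale_map c (vfield f)"
  by (simp add: vfield_def scale_map_def)

lemma vfield_add: "vfield (f + g) = vfield f + vfield g"
  by (simp add: vfield_def fun_eq_iff algebra_simps)

lemma module_hom_vfield: "module_hom smult scale_map vfield"
  by unfold_locales (auto simp: vfield_smult vfield_add)

lemma vfield_image_preimage:
  assumes "\<gg> \<subseteq> Der_poly"
  shows "vfield ` {u. vfield u \<in> \<gg>} = \<gg>"
  using assms by (auto simp: Der_poly_eq_range_vfield)

lemma inf_dim_coefficients:
  assumes g: "lie_subalgebra_Der \<gg>" and inf: "infinite_dimensional \<gg>"
  shows "polys.subspace {u. vfield u \<in> \<gg>}" "\<not> fin_dim {u. vfield u \<in> \<gg>}"
proof -
  interpret module_hom smult scale_map vfield by (rule module_hom_vfield)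
  show sub: "polys.subspace {u. vfield u \<in> \<gg>}"
    using g subspace_vimage[of \<gg>] by (simp add: lie_subalgebra_Der_def vimage_def)
  show "\<not> fin_dim {u. vfield u \<in> \<gg>}"
  proof
    assume "fin_dim {u. vfield u \<in> \<gg>}"
    then obtain B where "finite B" "polys.span B = {u. vfield u \<in> \<gg>}"
      using sub by (rule fin_dim_subspace_basis)
    then have "finite (vfield ` B)" "maps.span (vfield ` B) = \<gg>"
      using g by (auto simp: span_image vfield_image_preimage lie_subalgebra_Der_def)
    then show False using inf by (auto simp: infinite_dimensional_def)
  qed
qed

lemma lie_closed_coefficients:
  assumes "lie_subalgebra_Der \<gg>" "vfield u \<in> \<gg>" "vfield w \<in> \<gg>"
  shows "vfield (u * pderiv w - pderiv u * w) \<in> \<gg>"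
  using assms unfolding lie_subalgebra_Der_def by (metis lie_bracket_vfield)

section \<open>The Lie algebra differentiates its field of ratios\<close>

text \<open>
The elements \<open>x\<close> of \<open>K\<close> with \<open>u x' \<in> K\<close>. The quotient rule for one representing fraction replaces a
derivation on \<open>k(t)\<close>.
\<close>

definition derivable_ratios :: "'a::field poly fract set \<Rightarrow> 'a poly \<Rightarrow> 'a poly fract set"
  where "derivable_ratios K u =
    {Fract a b | a b. b \<noteq> 0 \<and> Fract a b \<in> K \<and> Fract (u * (pderiv a * b - a * pderiv b)) (b * b) \<in> K}"

text \<open>
The sum, product and reciprocal rules. Together with closure of \<open>K\<close> they reduce the inclusion
\<open>u K' \<subseteq> K\<close> to a set of generators of \<open>K\<close>.
\<close>

lemma subfield_derivable_ratios:
  assumes K: "subfield_over_consts K"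
  shows "subfield_over_consts (derivable_ratios K u)"
proof -
  have c: "\<And>c. to_fract [:c:] \<in> K"
    and ad: "\<And>x y. x \<in> K \<Longrightarrow> y \<in> K \<Longrightarrow> x + y \<in> K"
    and di: "\<And>x y. x \<in> K \<Longrightarrow> y \<in> K \<Longrightarrow> x - y \<in> K"
    and mu: "\<And>x y. x \<in> K \<Longrightarrow> y \<in> K \<Longrightarrow> x * y \<in> K"
    and inv: "\<And>x. x \<in> K \<Longrightarrow> x \<noteq> 0 \<Longrightarrow> inverse x \<in> K"
    using K by (auto simp: subfield_over_consts_def)
  let ?d = "\<lambda>a b. Fract (u * (pderiv a * b - a * pderiv b)) (b * b)"
  have I: "Fract a b \<in> derivable_ratios K u"
    if "b \<noteq> 0" "Fract a b \<in> K" "?d a b \<in> K" for a b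
    using that by (auto simp: derivable_ratios_def)
  have z: "0 \<in> K" using c[of 0] by simp
  have const: "to_fract [:c:] \<in> derivable_ratios K u" for c
    unfolding to_fract_def using c[of c] z by (intro I) (auto simp: to_fract_def fract_collapse)
  have "x + y \<in> derivable_ratios K u" "x - y \<in> derivable_ratios K u" "x * y \<in> derivable_ratios K u"
    if xy: "x \<in> derivable_ratios K u" "y \<in> derivable_ratios K u" for x y
  proof -
    obtain a b where x: "x = Fract a b" "b \<noteq> 0" "x \<in> K" "?d a b \<in> K"
      using xy(1) by (auto simp: derivable_ratios_def)
    obtain c d where y: "y = Fract c d" "d \<noteq> 0" "y \<in> K" "?d c d \<in> K"
      using xy(2) by (auto simp: derivable_ratios_def)
    have s: "x + y = Fract (a * d + c * b) (b * d)" "x - y = Fract (a * d - c * b) (b * d)"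
      "x * y = Fract (a * c) (b * d)"
      using x y by simp_all
    have "?d (a * d + c * b) (b * d) = ?d a b + ?d c d"
      using x(2) y(2) by (simp add: eq_fract pderiv_mult pderiv_add algebra_simps)
    then have "?d (a * d + c * b) (b * d) \<in> K" using ad[OF x(4) y(4)] by simp
    then show "x + y \<in> derivable_ratios K u"
      unfolding s(1) using x y s(1) ad[of x y] by (intro I) auto
    have "?d (a * d - c * b) (b * d) = ?d a b - ?d c d"
      using x(2) y(2) by (simp add: eq_fract pderiv_mult pderiv_diff algebra_simps)
    then have "?d (a * d - c * b) (b * d) \<in> K" using di[OF x(4) y(4)] by simp
    then show "x - y \<in> derivable_ratios K u"
      unfolding s(2) using x y s(2) di[of x y] by (intro I) auto
    have "?d (a * c) (b * d) = ?d a b * y + x * ?d c d"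
      unfolding x(1) y(1)
      using x(2) y(2) by (simp add: eq_fract pderiv_mult algebra_simps)
    then have "?d (a * c) (b * d) \<in> K"
      using ad[OF mu[OF x(4) y(3)] mu[OF x(3) y(4)]] by simp
    then show "x * y \<in> derivable_ratios K u"
      unfolding s(3) using x y s(3) mu[of x y] by (intro I) auto
  qed
  moreover have "inverse x \<in> derivable_ratios K u"
    if xE: "x \<in> derivable_ratios K u" and nz: "x \<noteq> 0" for x
  proof -
    obtain a b where x: "x = Fract a b" "b \<noteq> 0" "x \<in> K" "?d a b \<in> K"
      using xE by (auto simp: derivable_ratios_def)
    have a: "a \<noteq> 0" using nz x(1) by (auto simp: fract_collapse)
    have "?d b a = 0 - ?d a b * (inverse x * inverse x)"
      unfolding x(1) using x(2) a by (simp add: eq_fract Zero_fract_def algebra_simps)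
    also have "\<dots> \<in> K" using x nz by (intro di z mu inv)
    finally show ?thesis using x a inv[OF x(3) nz] by (auto intro!: I)
  qed
  ultimately show ?thesis using const unfolding subfield_over_consts_def by blast
qed

text \<open>
For a ratio \<open>w/v\<close> the quotient rule gives \<open>u (w/v)' = ((v w' - v' w)/v) (u/v)\<close>, and the first factor is
a ratio because its numerator is the coefficient of the bracket of \<open>v\<partial>\<close> and \<open>w\<partial>\<close>.
\<close>

lemma derivation_preserves_field_of_ratios:
  assumes g: "lie_subalgebra_Der \<gg>" and u: "vfield u \<in> \<gg>" and f: "to_fract f \<in> field_of_ratios \<gg>"
  shows "to_fract (u * pderiv f) \<in> field_of_ratios \<gg>"
proof (cases "u = 0")
  case True
  then show ?thesis
    using subfield_over_consts_adjoin[of "ratios \<gg>"]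
    by (simp add: field_of_ratios_def subfield_over_consts_def) (metis pCons_0_0 to_fract_0)
next
  case False
  let ?F = "field_of_ratios \<gg>"
  have F: "subfield_over_consts ?F"
    unfolding field_of_ratios_def by (rule subfield_over_consts_adjoin)
  have ratio: "Fract w v \<in> ?F" if "vfield w \<in> \<gg>" "vfield v \<in> \<gg>" "v \<noteq> 0" for w v
    using that subset_adjoin[of "ratios \<gg>"] by (auto simp: field_of_ratios_def ratios_def)
  have "ratios \<gg> \<subseteq> derivable_ratios ?F u"
  proof
    fix x assume "x \<in> ratios \<gg>"
    then obtain w v where wv: "x = Fract w v" "vfield w \<in> \<gg>" "vfield v \<in> \<gg>" "v \<noteq> 0"
      by (auto simp: ratios_def)
    have "Fract (v * pderiv w - pderiv v * w) v * Fract u v \<in> ?F"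
      using F ratio lie_closed_coefficients[OF g wv(3,2)] u wv(3,4)
      unfolding subfield_over_consts_def by blast
    moreover have "Fract (v * pderiv w - pderiv v * w) v * Fract u v
        = Fract (u * (pderiv w * v - w * pderiv v)) (v * v)"
      by (simp add: algebra_simps)
    ultimately have "Fract (u * (pderiv w * v - w * pderiv v)) (v * v) \<in> ?F" by simp
    then show "x \<in> derivable_ratios ?F u"
      using wv ratio by (auto simp: derivable_ratios_def)
  qed
  then have "?F \<subseteq> derivable_ratios ?F u"
    using adjoin_minimal subfield_derivable_ratios[OF F] unfolding field_of_ratios_def by blast
  then obtain a b where ab: "to_fract f = Fract a b" "b \<noteq> 0"
    "Fract (u * (pderiv a * b - a * pderiv b)) (b * b) \<in> ?F"
    using f by (auto simp: derivable_ratios_def)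
  have "a = f * b" using ab by (simp add: to_fract_def eq_fract)
  then have "Fract (u * (pderiv a * b - a * pderiv b)) (b * b) = to_fract (u * pderiv f)"
    using ab(2) by (simp add: to_fract_def eq_fract pderiv_mult algebra_simps)
  then show ?thesis using ab(3) by simp
qed

section \<open>A non-constant polynomial among the ratios\<close>

text \<open>
Within \<open>V\<close> the multiples \<open>u q\<close> of a fixed \<open>u \<noteq> 0\<close> form an infinite-dimensional space, so the ratios
\<open>q = u q / u\<close> cannot all be constants.
\<close>

lemma exists_poly_in_field_of_ratios:
  assumes g: "lie_subalgebra_Der \<gg>" and inf: "infinite_dimensional \<gg>"
  obtains f where "to_fract f \<in> field_of_ratios \<gg>" "degree f > 0"
proof -
  let ?V = "{u. vfield u \<in> \<gg>}"
  note V = inf_dim_coefficients[OF g inf]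
  have "\<exists>u\<in>?V. u \<noteq> 0"
  proof (rule ccontr)
    assume "\<not> ?thesis"
    then have "?V \<subseteq> polys.span {}" by auto
    then show False using V(2) unfolding fin_dim_def by blast
  qed
  then obtain u where u: "vfield u \<in> \<gg>" "u \<noteq> 0" by blast
  have "\<exists>q. vfield (u * q) \<in> \<gg> \<and> degree q > 0"
  proof (rule ccontr)
    assume no: "\<not> ?thesis"
    have "?V \<inter> {p. u dvd p} \<subseteq> polys.span {u}"
    proof
      fix p assume "p \<in> ?V \<inter> {p. u dvd p}"
      then obtain q where q: "p = u * q" "vfield (u * q) \<in> \<gg>" by (auto elim: dvdE)
      then obtain c where "q = [:c:]" using no degree_eq_zeroE by blast
      then show "p \<in> polys.span {u}"
        using polys.span_scale[OF polys.span_base[of u "{u}"], of c] by (simp add: q(1))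
    qed
    then have "fin_dim (?V \<inter> {p. u dvd p})" unfolding fin_dim_def by blast
    then show False using inf_dim_multiples[OF V u(2)] by blast
  qed
  then obtain q where q: "vfield (u * q) \<in> \<gg>" "degree q > 0" by blast
  have "Fract (u * q) u \<in> field_of_ratios \<gg>"
    using q(1) u subset_adjoin[of "ratios \<gg>"] by (auto simp: field_of_ratios_def ratios_def)
  moreover have "Fract (u * q) u = to_fract q" using u(2) by (simp add: to_fract_def eq_fract)
  ultimately show ?thesis using that q(2) by metis
qed

section \<open>The minimal cofactor and the theorem\<close>

text \<open>
Let \<open>m\<close> be the minimal cofactor, \<open>f' m = q(f)\<close> and \<open>f' u = p(f)\<close>. Dividing \<open>p\<close> by \<open>q\<close> and subtracting
the corresponding \<open>k[f]\<close>-multiple of \<open>m\<close> from \<open>u\<close> leaves a cofactor of smaller degree than \<open>m\<close>, which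
must vanish. The polynomial \<open>g\<close> ensures that the minimum is taken over a nonempty set.
\<close>

lemma multiple_of_min_cofactor:
  assumes f': "pderiv f \<noteq> 0" and u: "pderiv f * u \<in> poly_subring f"
    and g: "g \<noteq> 0" "pderiv f * g \<in> poly_subring f"
  shows "\<exists>p. u = pcompose p f * min_cofactor f"
proof -
  let ?P = "\<lambda>g. g \<noteq> 0 \<and> pderiv f * g \<in> poly_subring f"
  define m where "m = min_cofactor f"
  have m: "?P m" unfolding m_def min_cofactor_def by (rule arg_min_natI[of ?P g]) (use g in blast)
  have min: "degree m \<le> degree h" if "?P h" for h
    unfolding m_def min_cofactor_def using that by (rule arg_min_nat_le[of ?P])
  obtain q where q: "pderiv f * m = pcompose q f" using m by (auto simp: poly_subring_def)
  obtain p where p: "pderiv f * u = pcompose p f" using u by (auto simp: poly_subring_def)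
  define h where "h = u - pcompose (p div q) f * m"
  have h: "pderiv f * h = pcompose (p mod q) f"
  proof -
    have "pderiv f * h = pcompose p f - pcompose (p div q) f * pcompose q f"
      by (simp add: h_def p[symmetric] q[symmetric] algebra_simps)
    also have "\<dots> = pcompose (p - p div q * q) f" by (simp add: pcompose_diff pcompose_mult)
    finally show ?thesis by (simp add: minus_div_mult_eq_mod)
  qed
  have "h = 0"
  proof (rule ccontr)
    assume nz: "h \<noteq> 0"
    then have "degree m \<le> degree h" using min[of h] h by (auto simp: poly_subring_def)
    then have "degree (pderiv f * m) \<le> degree (pderiv f * h)"
      using f' nz m by (simp add: degree_mult_eq)
    moreover have "degree (pderiv f * h) = degree (p mod q) * degree f"
      "degree (pderiv f * m) = degree q * degree f"
      by (simp_all add: h q degree_pcompose)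
    ultimately have "degree q * degree f \<le> degree (p mod q) * degree f"
      by simp
    moreover have "degree f > 0" using f' by (metis degree_eq_zeroE gr0I pderiv_singleton)
    ultimately have "degree q \<le> degree (p mod q)" by simp
    moreover have "p mod q \<noteq> 0" using h nz f' by auto
    moreover have "q \<noteq> 0" using q m f' by auto
    ultimately show False using degree_mod_less[of q p] by auto
  qed
  then show ?thesis by (auto simp: h_def m_def)
qed

theorem theorem0p5:
  fixes \<gg> :: "('k::field_char_0 poly \<Rightarrow> 'k poly) set"
  assumes "lie_subalgebra_Der \<gg>" and "infinite_dimensional \<gg>"
  shows "\<exists>f :: 'k poly. degree f > 0 \<and>
           field_of_ratios \<gg> = adjoin {to_fract f} \<and>
           \<gg> \<subseteq> L_alg f"
proof -
  let ?F = "field_of_ratios \<gg>"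
  note g = assms(1)
  have F: "subfield_over_consts ?F"
    unfolding field_of_ratios_def by (rule subfield_over_consts_adjoin)
  obtain f\<^sub>0 where f\<^sub>0: "to_fract f\<^sub>0 \<in> ?F" "degree f\<^sub>0 > 0"
    using exists_poly_in_field_of_ratios[OF assms] .
  obtain f where f: "degree f > 0" and A: "{p. to_fract p \<in> ?F} = poly_subring f"
    using division_closed_subring.generated_by_one_polynomial[OF division_closed_subring_polys[OF F], of f\<^sub>0] f\<^sub>0
    by auto
  have fF: "to_fract f \<in> ?F"
  proof -
    have "pcompose [:0, 1:] f = f" by (simp add: pcompose_pCons)
    then have "f \<in> poly_subring f" unfolding poly_subring_def by (metis (mono_tags) mem_Collect_eq)
    then show ?thesis using A by blast
  qed
  have cofactor: "pderiv f * u \<in> poly_subring f" if "vfield u \<in> \<gg>" for u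
    using derivation_preserves_field_of_ratios[OF g that fF] A by (auto simp: mult.commute)
  have "?F = adjoin {to_fract f}"
  proof
    show "adjoin {to_fract f} \<subseteq> ?F" by (intro adjoin_minimal F) (simp add: fF)
    let ?E = "adjoin {to_fract f}"
    have E: "subfield_over_consts ?E" by (rule subfield_over_consts_adjoin)
    interpret E: division_closed_subring "{p. to_fract p \<in> ?E}" using E by (rule division_closed_subring_polys)
    have fE: "f \<in> {p. to_fract p \<in> ?E}" using subset_adjoin[of "{to_fract f}"] by blast
    have sub: "to_fract a \<in> ?F \<Longrightarrow> to_fract a \<in> ?E" for a
      using E.poly_subring_subset[OF fE] A by blast
    show "?F \<subseteq> ?E"
    proof
      fix x assume "x \<in> ?F"
      then obtain a b where ab: "to_fract a \<in> ?F" "to_fract b \<in> ?F" "b \<noteq> 0" "x = Fract a b"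
        using subfield_elem_eq_quotient[OF F f\<^sub>0] by blast
      then show "x \<in> ?E"
        using subfield_divide[OF E sub[OF ab(1)] sub[OF ab(2)]] by (simp add: Fract_conv_to_fract)
    qed
  qed
  moreover have "\<gg> \<subseteq> L_alg f"
  proof
    fix D assume D: "D \<in> \<gg>"
    then have "D \<in> vfield ` {u. vfield u \<in> \<gg>}"
      using g by (simp add: vfield_image_preimage lie_subalgebra_Der_def)
    then obtain u where u: "D = vfield u" "vfield u \<in> \<gg>" by blast
    show "D \<in> L_alg f"
    proof (cases "u = 0")
      case True
      then have "D = vfield (pcompose 0 f * min_cofactor f)" by (simp add: u(1))
      then show ?thesis unfolding L_alg_def by blast
    next
      case False
      have "pderiv f \<noteq> 0" using f by (simp add: pderiv_eq_0_iff)
      then obtain p where "u = pcompose p f * min_cofactor f"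
        using multiple_of_min_cofactor[OF _ cofactor[OF u(2)] False cofactor[OF u(2)]] by blast
      then show ?thesis unfolding L_alg_def u(1) by blast
    qed
  qed
  ultimately show ?thesis using f by blast
qed

end
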